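(* Let $K$ be a field of characteristic zero, and let $L$ be the two-dimensional non-abelian Lie algebra over $K$ with basis $\{x,y\}$ and Lie bracket determined by $[x,y]_L=y$. Let $U(L)$ be its universal enveloping algebra and let $U^k(L)=(U(L),*,\alpha_k)$, $k\in K^\times$, be the hom-associative universal enveloping algebras of $L$. Then $U^k(L)$ is a one-parameter formal hom-associative deformation of $U(L)$.
   Context: **Hom-associative algebras.** A hom-associative algebra over an associative, commutative, unital ring $R$ is a triple $(M,\cdot,\alpha)$ consisting of an $R$-module $M$, a binary operation $\cdot\colon M\times M\to M$ linear over $R$ in both arguments, and an $R$-linear map $\alpha\colon M\to M$ (the twisting map) such that $\alpha(a)\cdot(b\cdot c)=(a\cdot b)\cdot\alpha(c)$ for all $a,b,c\in M$. An associative algebra is regarded as a hom-associative algebra whose twisting map is the identity. **One-parameter formal hom-associative deformation.** For an $R$-module $M$, $M\llbracket t\rrbracket$ denotes the $R\llbracket t\rrbracket$-module of formal power series in the indeterminate $t$ with coefficients in $M$. A one-parameter formal hom-associative deformation of a hom-associative algebra $(M,\cdot_0,\alpha_0)$ over $R$ is a hom-associative algebra $(M\llbracket t\rrbracket,\cdot_t,\alpha_t)$ over $R\llbracket t\rrbracket$, where $\cdot_t=\sum_{i=0}^\infty\cdot_i\,t^i$ and $\alpha_t=\sum_{i=0}^\infty\alpha_it^i$. Here, for each $i\in\mathbb{N}_0$ (the nonnegative integers), $\cdot_i\colon M\times M\to M$ is a binary operation linear over $R$ in both arguments and $\alpha_i\colon M\to M$ is an $R$-linear map, extended homogeneously (that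 is, coefficientwise in powers of $t$) to a binary operation on $M\llbracket t\rrbracket$ linear over $R\llbracket t\rrbracket$ in both arguments and to an $R\llbracket t\rrbracket$-linear map on $M\llbracket t\rrbracket$, respectively. **Universal enveloping algebra.** $U(L)$ is isomorphic to the unital associative Ore extension $K[y][x;\mathrm{id}_{K[y]},\delta]$ with $\delta=y\frac{\mathrm{d}}{\mathrm{d}y}$, so that $x\cdot y-y\cdot x=y$; it has $K$-basis $\{y^mx^n: m,n\in\mathbb{N}_0\}$. **Hom-associative universal enveloping algebras.** For $k\in K^\times$, $\alpha_k$ is the $K$-algebra endomorphism of $K[y]$ with $\alpha_k(y)=ky$, extended homogeneously in $x$, so that $\alpha_k(ay^mx^n)=ak^my^mx^n$ for $a\in K$. With $a*b:=\alpha_k(a\cdot b)$, the triple $U^k(L)=(U(L),*,\alpha_k)$ is a hom-associative algebra. These algebras form a family with parameter $k$, whose member at $k=1$ is $U(L)$ itself; the statement concerns this $k$-family. *)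

theory Defs
  imports "HOL-Library.Poly_Mapping" "HOL-Computational_Algebra.Formal_Power_Series"
begin

section \<open>Hom-associative algebras and their formal deformations\<close>

definition bilinear_op ::
  "('r::comm_ring_1 \<Rightarrow> 'm::ab_group_add \<Rightarrow> 'm) \<Rightarrow> ('m \<Rightarrow> 'm \<Rightarrow> 'm) \<Rightarrow> bool" where
  "bilinear_op scale m \<longleftrightarrow>
     (\<forall>a. module_hom scale scale (\<lambda>b. m a b)) \<and> (\<forall>b. module_hom scale scale (\<lambda>a. m a b))"

locale hom_associative_algebra = module scale
  for scale :: "'r::comm_ring_1 \<Rightarrow> 'm::ab_group_add \<Rightarrow> 'm" +
  fixes m :: "'m \<Rightarrow> 'm \<Rightarrow> 'm" and \<alpha> :: "'m \<Rightarrow> 'm"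
  assumes bilinear: "bilinear_op scale m"
    and linear_twist: "module_hom scale scale \<alpha>"
    and hom_assoc: "m (\<alpha> a) (m b c) = m (m a b) (\<alpha> c)"

text \<open>The underlying set of $M[[t]]$ is \<open>'m fps\<close>; the following makes it an $R[[t]]$-module.\<close>

definition fps_scale ::
  "('r::comm_ring_1 \<Rightarrow> 'm::ab_group_add \<Rightarrow> 'm) \<Rightarrow> 'r fps \<Rightarrow> 'm fps \<Rightarrow> 'm fps" where
  "fps_scale scale r a = Abs_fps (\<lambda>n. \<Sum>i\<le>n. scale (fps_nth r i) (fps_nth a (n - i)))"

text \<open>$\alpha_t = \sum_i \alpha_i t^i$ and $\cdot_t = \sum_i \cdot_i\, t^i$, each coefficient being
  extended homogeneously to $M[[t]]$.\<close>

definition formal_map :: "(nat \<Rightarrow> 'm \<Rightarrow> 'm) \<Rightarrow> 'm::ab_group_add fps \<Rightarrow> 'm fps" where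
  "formal_map \<alpha> a = Abs_fps (\<lambda>n. \<Sum>i\<le>n. \<alpha> i (fps_nth a (n - i)))"

definition formal_mult ::
  "(nat \<Rightarrow> 'm \<Rightarrow> 'm \<Rightarrow> 'm) \<Rightarrow> 'm::ab_group_add fps \<Rightarrow> 'm fps \<Rightarrow> 'm fps" where
  "formal_mult m a b =
     Abs_fps (\<lambda>n. \<Sum>i\<le>n. \<Sum>j\<le>n - i. m i (fps_nth a j) (fps_nth b (n - i - j)))"

definition formal_hom_assoc_deformation ::
  "('r::comm_ring_1 \<Rightarrow> 'm::ab_group_add \<Rightarrow> 'm) \<Rightarrow> ('m \<Rightarrow> 'm \<Rightarrow> 'm) \<Rightarrow> ('m \<Rightarrow> 'm) \<Rightarrow>
   (nat \<Rightarrow> 'm \<Rightarrow> 'm \<Rightarrow> 'm) \<Rightarrow> (nat \<Rightarrow> 'm \<Rightarrow> 'm) \<Rightarrow> bool" where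
  "formal_hom_assoc_deformation scale m0 \<alpha>0 m \<alpha> \<longleftrightarrow>
     hom_associative_algebra scale m0 \<alpha>0 \<and>
     m 0 = m0 \<and> \<alpha> 0 = \<alpha>0 \<and>
     (\<forall>i. bilinear_op scale (m i)) \<and>
     (\<forall>i. module_hom scale scale (\<alpha> i)) \<and>
     hom_associative_algebra (fps_scale scale) (formal_mult m) (formal_map \<alpha>)"

section \<open>Lie algebras and universal enveloping algebras\<close>

locale lie_algebra = vector_space scale
  for scale :: "'k::field \<Rightarrow> 'l::ab_group_add \<Rightarrow> 'l" +
  fixes bracket :: "'l \<Rightarrow> 'l \<Rightarrow> 'l"
  assumes bilinear: "bilinear_op scale bracket"
    and alternating: "bracket a a = 0"
    and jacobi: "bracket a (bracket b c) + bracket b (bracket c a) + bracket c (bracket a b) = 0"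

locale assoc_algebra = vector_space scale
  for scale :: "'k::field \<Rightarrow> 'u::ring_1 \<Rightarrow> 'u" +
  assumes scale_mult_left: "scale c (a * b) = scale c a * b"
    and scale_mult_right: "scale c (a * b) = a * scale c b"

definition algebra_hom ::
  "('k::field \<Rightarrow> 'a::ring_1 \<Rightarrow> 'a) \<Rightarrow> ('k \<Rightarrow> 'b::ring_1 \<Rightarrow> 'b) \<Rightarrow> ('a \<Rightarrow> 'b) \<Rightarrow> bool" where
  "algebra_hom scaleA scaleB f \<longleftrightarrow>
     module_hom scaleA scaleB f \<and> f 1 = 1 \<and> (\<forall>a b. f (a * b) = f a * f b)"

text \<open>The free monoid, written additively so that \<open>'l free_monoid \<Rightarrow>\<^sub>0 'k\<close> is its monoid algebra,
  i.e. the free unital associative algebra on the set \<open>'l\<close>.\<close>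

datatype 'l free_monoid = Mon (letters: "'l list")

instantiation free_monoid :: (type) monoid_add
begin
definition zero_free_monoid :: "'a free_monoid" where "0 = Mon []"
definition plus_free_monoid :: "'a free_monoid \<Rightarrow> 'a free_monoid \<Rightarrow> 'a free_monoid" where
  "u + v = Mon (letters u @ letters v)"
instance
  by standard (auto simp: zero_free_monoid_def plus_free_monoid_def)
end

type_synonym ('l, 'k) free_algebra = "'l free_monoid \<Rightarrow>\<^sub>0 'k"

definition free_scale :: "'k::field \<Rightarrow> ('l, 'k) free_algebra \<Rightarrow> ('l, 'k) free_algebra" where
  "free_scale c p = Poly_Mapping.single 0 c * p"

definition free_gen :: "'l \<Rightarrow> ('l, 'k::field) free_algebra" where
  "free_gen a = Poly_Mapping.single (Mon [a]) 1"

lemma assoc_algebra_free_scale: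
  "assoc_algebra (free_scale :: 'k::field \<Rightarrow> ('l, 'k) free_algebra \<Rightarrow> _)"
proof
  have comm: "Poly_Mapping.single 0 c * a = a * Poly_Mapping.single 0 c"
    for c :: 'k and a :: "('l, 'k) free_algebra"
  proof (induction a rule: update_induct)
    case const
    show ?case by simp
  next
    case (update f u d)
    have "Poly_Mapping.update u d f = f + Poly_Mapping.single u d"
      using update(1)
      by (intro poly_mapping_eqI)
         (auto simp: lookup_update lookup_add lookup_single when_def in_keys_iff)
    then show ?case
      using update(3) by (simp add: Poly_Mapping.mult_single distrib_left distrib_right mult.commute)
  qed
  fix c d :: 'k and a b :: "('l, 'k) free_algebra"
  show "free_scale c (a + b) = free_scale c a + free_scale c b"
    by (simp add: free_scale_def distrib_left)
  show "free_scale (c + d) a = free_scale c a + free_scale d a"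
    by (simp add: free_scale_def single_add distrib_right)
  show "free_scale c (free_scale d a) = free_scale (c * d) a"
    by (simp add: free_scale_def mult.assoc[symmetric] Poly_Mapping.mult_single)
  show "free_scale 1 a = a"
    by (simp add: free_scale_def)
  show "free_scale c (a * b) = free_scale c a * b"
    by (simp add: free_scale_def mult.assoc)
  show "free_scale c (a * b) = a * free_scale c b"
    unfolding free_scale_def by (metis comm mult.assoc)
qed

inductive_set two_sided_ideal :: "'a::ring_1 set \<Rightarrow> 'a set" for S where
  generator: "s \<in> S \<Longrightarrow> s \<in> two_sided_ideal S"
| zero: "0 \<in> two_sided_ideal S"
| add: "a \<in> two_sided_ideal S \<Longrightarrow> b \<in> two_sided_ideal S \<Longrightarrow> a + b \<in> two_sided_ideal S"
| mult_left: "a \<in> two_sided_ideal S \<Longrightarrow> r * a \<in> two_sided_ideal S"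
| mult_right: "a \<in> two_sided_ideal S \<Longrightarrow> a * r \<in> two_sided_ideal S"

text \<open>The first two families of relators present the tensor algebra of the vector space \<open>'l\<close> as a
  quotient of the free algebra on the set \<open>'l\<close>; the third one imposes
  $a \otimes b - b \otimes a = [a,b]$.\<close>

definition uea_relators ::
  "('k::field \<Rightarrow> 'l::ab_group_add \<Rightarrow> 'l) \<Rightarrow> ('l \<Rightarrow> 'l \<Rightarrow> 'l) \<Rightarrow> ('l, 'k) free_algebra set" where
  "uea_relators scaleL bracket =
     {free_gen (a + b) - (free_gen a + free_gen b) | a b. True} \<union>
     {free_gen (scaleL c a) - free_scale c (free_gen a) | c a. True} \<union>
     {free_gen a * free_gen b - free_gen b * free_gen a - free_gen (bracket a b) | a b. True}"

text \<open>The algebra \<open>'u\<close> together with \<open>\<iota> :: 'l \<Rightarrow> 'u\<close> is (a copy of) the universal enveloping algebra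
  $T(L)/(a \otimes b - b \otimes a - [a,b])$ with its canonical map from $L$; it is expressed up to
  isomorphism because the quotient depends on the bracket and so cannot be a type.\<close>

definition universal_enveloping_algebra ::
  "('k::field \<Rightarrow> 'l::ab_group_add \<Rightarrow> 'l) \<Rightarrow> ('l \<Rightarrow> 'l \<Rightarrow> 'l) \<Rightarrow>
   ('k \<Rightarrow> 'u::ring_1 \<Rightarrow> 'u) \<Rightarrow> ('l \<Rightarrow> 'u) \<Rightarrow> bool" where
  "universal_enveloping_algebra scaleL bracket scaleU \<iota> \<longleftrightarrow>
     lie_algebra scaleL bracket \<and> assoc_algebra scaleU \<and>
     (\<exists>\<phi> :: ('l, 'k) free_algebra \<Rightarrow> 'u.
        algebra_hom free_scale scaleU \<phi> \<and> (\<forall>a. \<phi> (free_gen a) = \<iota> a) \<and> surj \<phi> \<and>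
        {p. \<phi> p = 0} = two_sided_ideal (uea_relators scaleL bracket))"

section \<open>The hom-associative universal enveloping algebras $U^k(L)$\<close>

text \<open>Here \<open>X\<close>, \<open>Y\<close> are the images of $x$, $y$ in $U(L)$. The map is well defined since the
  \<open>Y ^ i * X ^ j\<close> form a basis of $U(L)$.\<close>

definition uk_twist :: "('k::field \<Rightarrow> 'u::ring_1 \<Rightarrow> 'u) \<Rightarrow> 'u \<Rightarrow> 'u \<Rightarrow> 'k \<Rightarrow> 'u \<Rightarrow> 'u" where
  "uk_twist scaleU X Y k = (THE f. module_hom scaleU scaleU f \<and>
     (\<forall>i j. f (Y ^ i * X ^ j) = scaleU (k ^ i) (Y ^ i * X ^ j)))"

definition uk_mult :: "('k::field \<Rightarrow> 'u::ring_1 \<Rightarrow> 'u) \<Rightarrow> 'u \<Rightarrow> 'u \<Rightarrow> 'k \<Rightarrow> 'u \<Rightarrow> 'u \<Rightarrow> 'u" where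
  "uk_mult scaleU X Y k a b = uk_twist scaleU X Y k (a * b)"

text \<open>A family of algebras \<open>(M, mK k, \<alpha>K k)\<close>, for nonzero \<open>k\<close>, is regarded as a one-parameter formal
  hom-associative deformation of \<open>(M, m0, \<alpha>0)\<close>, with formal parameter $t = k - k_0$: the
  operations of the family expand as $\sum_i (k - k_0)^i m_i$ and $\sum_i (k - k_0)^i \alpha_i$
  (finite sums on each argument, hence meaningful without topology), and the coefficients \<open>m\<close>,
  \<open>\<alpha>\<close> define a formal deformation. Over an infinite field the coefficients are determined by the
  family.\<close>

definition family_is_formal_deformation ::
  "('k::field \<Rightarrow> 'm::ab_group_add \<Rightarrow> 'm) \<Rightarrow> ('m \<Rightarrow> 'm \<Rightarrow> 'm) \<Rightarrow> ('m \<Rightarrow> 'm) \<Rightarrow> 'k \<Rightarrow>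
   ('k \<Rightarrow> 'm \<Rightarrow> 'm \<Rightarrow> 'm) \<Rightarrow> ('k \<Rightarrow> 'm \<Rightarrow> 'm) \<Rightarrow> bool" where
  "family_is_formal_deformation scale m0 \<alpha>0 k0 mK \<alpha>K \<longleftrightarrow>
     (\<exists>m \<alpha>. formal_hom_assoc_deformation scale m0 \<alpha>0 m \<alpha> \<and>
       (\<forall>a b. finite {i. m i a b \<noteq> 0}) \<and> (\<forall>a. finite {i. \<alpha> i a \<noteq> 0}) \<and>
       (\<forall>k. k \<noteq> 0 \<longrightarrow>
         (\<forall>a b. mK k a b = (\<Sum>i | m i a b \<noteq> 0. scale ((k - k0) ^ i) (m i a b))) \<and>
         (\<forall>a. \<alpha>K k a = (\<Sum>i | \<alpha> i a \<noteq> 0. scale ((k - k0) ^ i) (\<alpha> i a)))))"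

end

theory Submission
  imports Defs
begin

text \<open>By the universal property of $U(L)$ there is an algebra homomorphism
  $F \colon U(L) \to U(L)[[t]]$ with $F(x) = x$ and $F(y) = (1 + t) y$, because the relation
  $x y - y x = y$ is homogeneous in $y$. Its coefficients $\alpha_n$ satisfy
  $\alpha_n(y^i x^j) = \binom{i}{n} y^i x^j$, so by the binomial theorem $\sum_n (k - 1)^n \alpha_n$
  is the twisting map at parameter $k$. The $K[[t]]$-linear extension of $F$ is again
  multiplicative, which makes hom-associativity of $a \cdot_t b = \alpha_t(a b)$ immediate.
  Only the fact that the monomials $y^i x^j$ span $U(L)$ is needed, not their linear
  independence: the twisting map, given by a definite description, exists because $F$ does.\<close>

section \<open>The universal property\<close>

text \<open>Updating an element at a word outside its support amounts to adding a single term there.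
  In this additive form the induction step can be closed by additivity of a map alone.\<close>

lemma free_algebra_induct [case_names zero add]:
  fixes p :: "('l, 'k::field) free_algebra"
  assumes "P 0" and "\<And>p u c. P p \<Longrightarrow> P (p + Poly_Mapping.single u c)"
  shows "P p"
proof (induction p rule: update_induct)
  case const
  show ?case by (rule assms(1))
next
  case (update f u d)
  have "Poly_Mapping.update u d f = f + Poly_Mapping.single u d"
    using update(1)
    by (intro poly_mapping_eqI)
       (auto simp: lookup_update lookup_add lookup_single when_def in_keys_iff)
  then show ?case
    using assms(2)[OF update(3)] by simp
qed

text \<open>The evaluation homomorphism of the free algebra at \<open>g\<close>: a word goes to the
  product of the images of its letters, extended linearly.\<close>

definition free_lift ::
  "('k::field \<Rightarrow> 'b::ring_1 \<Rightarrow> 'b) \<Rightarrow> ('l \<Rightarrow> 'b) \<Rightarrow> ('l, 'k) free_algebra \<Rightarrow> 'b" where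
  "free_lift scale g p =
     (\<Sum>u\<in>Poly_Mapping.keys p. scale (Poly_Mapping.lookup p u) (prod_list (map g (letters u))))"

context assoc_algebra
begin

text \<open>Padding with zero terms lets \<open>p\<close>, \<open>q\<close> and
  \<open>p + q\<close>, whose supports differ, be summed over one common index set.\<close>

lemma free_lift_superset:
  assumes "finite S" "Poly_Mapping.keys p \<subseteq> S"
  shows "free_lift scale g p =
    (\<Sum>u\<in>S. scale (Poly_Mapping.lookup p u) (prod_list (map g (letters u))))"
  unfolding free_lift_def
  using assms by (intro sum.mono_neutral_left) (auto simp: in_keys_iff)

lemma free_lift_zero [simp]: "free_lift scale g 0 = 0"
  by (simp add: free_lift_def)

lemma free_lift_single [simp]:
  "free_lift scale g (Poly_Mapping.single u c) = scale c (prod_list (map g (letters u)))"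
  by (subst free_lift_superset[of "{u}"]) auto

lemma free_lift_add: "free_lift scale g (p + q) = free_lift scale g p + free_lift scale g q"
proof -
  let ?S = "Poly_Mapping.keys p \<union> Poly_Mapping.keys q"
  have "Poly_Mapping.keys (p + q) \<subseteq> ?S"
    by (rule keys_add)
  then show ?thesis
    by (simp add: free_lift_superset[of ?S] lookup_add scale_left_distrib sum.distrib)
qed

lemma free_lift_diff: "free_lift scale g (p - q) = free_lift scale g p - free_lift scale g q"
  by (metis add_diff_cancel_right' diff_add_cancel free_lift_add)

text \<open>By biadditivity both factors reduce to single terms; there concatenation of words
  becomes multiplication of the evaluated products.\<close>

lemma free_lift_mult: "free_lift scale g (p * q) = free_lift scale g p * free_lift scale g q"
proof (induction p rule: free_algebra_induct)
  case zero
  show ?case by simp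
next
  case (add p u c)
  have "free_lift scale g (Poly_Mapping.single u c * q) =
    free_lift scale g (Poly_Mapping.single u c) * free_lift scale g q"
  proof (induction q rule: free_algebra_induct)
    case zero
    show ?case by simp
  next
    case (add q v d)
    then show ?case
      by (simp add: distrib_left free_lift_add Poly_Mapping.mult_single plus_free_monoid_def
          scale_mult_left[symmetric] scale_mult_right[symmetric])
  qed
  with add show ?case
    by (simp add: distrib_right free_lift_add)
qed

lemma free_lift_gen [simp]: "free_lift scale g (free_gen a) = g a"
  by (simp add: free_gen_def)

lemma free_lift_one [simp]: "free_lift scale g 1 = 1"
  by (simp add: single_one[symmetric] zero_free_monoid_def del: single_one)

lemma free_lift_scale: "free_lift scale g (free_scale c p) = scale c (free_lift scale g p)"
  by (simp add: free_scale_def free_lift_mult zero_free_monoid_def scale_mult_left[symmetric])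

end

section \<open>Factoring through the ideal of relations\<close>

text \<open>Linearity of \<open>g\<close> and its compatibility with the bracket say exactly that
  the evaluation at \<open>g\<close> kills the three families of relators. It then kills the ideal
  they generate, which is the kernel of the surjection \<phi>, and so factors through
  \<phi>.\<close>

theorem uea_universal_property:
  assumes uea: "universal_enveloping_algebra scaleL bracket scaleU \<iota>"
    and B: "assoc_algebra scaleB"
    and g: "module_hom scaleL scaleB g"
    and g_bracket: "\<And>a b. g a * g b - g b * g a = g (bracket a b)"
  obtains F where "algebra_hom scaleU scaleB F" and "\<And>a. F (\<iota> a) = g a"
proof -
  interpret U: assoc_algebra scaleU
    using uea by (simp add: universal_enveloping_algebra_def)
  interpret B: assoc_algebra scaleB by (rule B)
  interpret g: module_hom scaleL scaleB g by (rule g)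
  obtain \<phi> where \<phi>: "algebra_hom free_scale scaleU \<phi>" "\<And>a. \<phi> (free_gen a) = \<iota> a" "surj \<phi>"
    and ker: "{p. \<phi> p = 0} = two_sided_ideal (uea_relators scaleL bracket)"
    using uea unfolding universal_enveloping_algebra_def by blast
  interpret \<phi>: module_hom free_scale scaleU \<phi>
    using \<phi>(1) by (simp add: algebra_hom_def)
  have \<phi>_mult: "\<phi> (p * q) = \<phi> p * \<phi> q" and \<phi>_one: "\<phi> 1 = 1" for p q
    using \<phi>(1) by (auto simp: algebra_hom_def)
  define G where "G = free_lift scaleB g"
  \<comment> \<open>Induction on the generation of the ideal: \<open>G\<close> is additive and
    multiplicative, so only the relators need a computation.\<close>
  have "G p = 0" if "p \<in> two_sided_ideal (uea_relators scaleL bracket)" for p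
    using that
  proof induction
    case (generator s)
    then show ?case
      by (auto simp: uea_relators_def G_def B.free_lift_diff B.free_lift_add B.free_lift_scale
          B.free_lift_mult g.add g.scale g_bracket)
  qed (simp_all add: G_def B.free_lift_add B.free_lift_mult)
  with ker have G0: "G p = 0" if "\<phi> p = 0" for p
    using that by blast
  have G_cong: "G p = G q" if "\<phi> p = \<phi> q" for p q
    using G0[of "p - q"] that by (simp add: \<phi>.diff G_def B.free_lift_diff)
  \<comment> \<open>The preimage picked by \<open>inv \<phi>\<close> is arbitrary;
    \<open>G_cong\<close> makes the value of \<open>F\<close> independent of that choice.\<close>
  define F where "F = G \<circ> inv \<phi>"
  have F: "F (\<phi> p) = G p" for p
    unfolding F_def o_def by (rule G_cong) (simp add: surj_f_inv_f[OF \<phi>(3)])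
  have "algebra_hom scaleU scaleB F"
    unfolding algebra_hom_def
  proof (intro conjI allI)
    show "F 1 = 1"
      by (metis F \<phi>_one G_def B.free_lift_one)
    show F_mult: "F (a * b) = F a * F b" for a b
      by (metis F \<phi>_mult G_def B.free_lift_mult \<phi>(3) surjD)
    show "module_hom scaleU scaleB F"
    proof unfold_locales
      show "F (a + b) = F a + F b" for a b
        by (metis F \<phi>.add G_def B.free_lift_add \<phi>(3) surjD)
      show "F (scaleU c a) = scaleB c (F a)" for c a
        by (metis F \<phi>.scale G_def B.free_lift_scale \<phi>(3) surjD)
    qed
  qed
  moreover have "F (\<iota> a) = g a" for a
    by (metis F G_def \<phi>(2) B.free_lift_gen)
  ultimately show ?thesis by (rule that)
qed

text \<open>The image of L generates U(L) as an algebra: \<phi> is surjective, and every word is a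
  product of generators.\<close>

lemma uea_induct [consumes 1, case_names gen add scale one mult]:
  fixes scaleU :: "'k::field \<Rightarrow> 'u::ring_1 \<Rightarrow> 'u"
  assumes uea: "universal_enveloping_algebra scaleL bracket scaleU \<iota>"
    and gen: "\<And>a. P (\<iota> a)"
    and add: "\<And>u v. P u \<Longrightarrow> P v \<Longrightarrow> P (u + v)"
    and scale: "\<And>c u. P u \<Longrightarrow> P (scaleU c u)"
    and one: "P 1"
    and mult: "\<And>u v. P u \<Longrightarrow> P v \<Longrightarrow> P (u * v)"
  shows "P u"
proof -
  interpret U: assoc_algebra scaleU
    using uea by (simp add: universal_enveloping_algebra_def)
  obtain \<phi> where \<phi>: "algebra_hom free_scale scaleU \<phi>" "\<And>a. \<phi> (free_gen a) = \<iota> a" "surj \<phi>"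
    using uea unfolding universal_enveloping_algebra_def by blast
  interpret \<phi>: module_hom free_scale scaleU \<phi>
    using \<phi>(1) by (simp add: algebra_hom_def)
  have \<phi>_mult: "\<phi> (p * q) = \<phi> p * \<phi> q" and \<phi>_one: "\<phi> 1 = 1" for p q
    using \<phi>(1) by (auto simp: algebra_hom_def)
  have word: "P (\<phi> (Poly_Mapping.single (Mon w) 1))" for w
  proof (induction w)
    case Nil
    then show ?case
      using one \<phi>_one by (simp add: single_one[symmetric] zero_free_monoid_def del: single_one)
  next
    case (Cons a w)
    have "Poly_Mapping.single (Mon (a # w)) 1 =
        (free_gen a * Poly_Mapping.single (Mon w) 1 :: ('a, 'k) free_algebra)"
      by (simp add: free_gen_def Poly_Mapping.mult_single plus_free_monoid_def)
    with Cons gen mult show ?case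
      by (simp add: \<phi>_mult \<phi>(2))
  qed
  have "P (\<phi> p)" for p
  proof (induction p rule: free_algebra_induct)
    case zero
    \<comment> \<open>The rule has no case for zero; it is recovered as 0 times the unit.\<close>
    have "P (scaleU 0 1)" by (intro scale one)
    then show ?case by (simp add: \<phi>.zero)
  next
    case (add p u c)
    have "Poly_Mapping.single u c = free_scale c (Poly_Mapping.single (Mon (letters u)) 1)"
      by (simp add: free_scale_def Poly_Mapping.mult_single)
    with add show ?case
      by (simp only: \<phi>.add \<phi>.scale) (intro assms(3) scale word)
  qed
  with \<phi>(3) show ?thesis by (metis surjD)
qed

section \<open>Formal power series over an algebra\<close>

context assoc_algebra
begin

text \<open>A scalar series acts as multiplication by its image in U[[t]], so the module laws become
  ring laws of U[[t]].\<close>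

lemma fps_scale_eq_mult: "fps_scale scale r f = Abs_fps (\<lambda>n. scale (fps_nth r n) 1) * f"
  by (rule fps_ext)
     (simp add: fps_scale_def fps_mult_nth scale_mult_left[symmetric] atMost_atLeast0)

lemma fps_scale_mult_left: "fps_scale scale r (f * g) = fps_scale scale r f * g"
  by (simp add: fps_scale_eq_mult mult.assoc)

lemma fps_scale_eq_mult_right: "fps_scale scale r f = f * Abs_fps (\<lambda>n. scale (fps_nth r n) 1)"
proof (rule fps_ext)
  fix n
  show "fps_nth (fps_scale scale r f) n = fps_nth (f * Abs_fps (\<lambda>n. scale (fps_nth r n) 1)) n"
    unfolding fps_scale_def fps_mult_nth atMost_atLeast0[symmetric] fps_nth_Abs_fps
    \<comment> \<open>Scalar multiples of 1 are central, so the two convolutions differ only by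
      reversing the index.\<close>
    by (rule sum.reindex_bij_witness[where i = "\<lambda>i. n - i" and j = "\<lambda>i. n - i"])
       (auto simp: scale_mult_right[symmetric])
qed

lemma fps_scale_mult_right: "fps_scale scale r (f * g) = f * fps_scale scale r g"
  by (simp add: fps_scale_eq_mult_right mult.assoc)

lemma fps_scale_const: "fps_scale scale (fps_const c) f = Abs_fps (\<lambda>n. scale c (fps_nth f n))"
  by (rule fps_ext)
     (simp add: fps_scale_eq_mult fps_mult_nth fps_const_def if_distrib[of "\<lambda>c. scale c _"]
       if_distrib[of "\<lambda>c. c * _"] scale_mult_left[symmetric] cong: if_cong)

lemma module_fps_scale: "module (fps_scale scale)"
proof
  fix r s and f g
  have e_mult: "Abs_fps (\<lambda>n. scale (fps_nth (r * s) n) 1) =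
      Abs_fps (\<lambda>n. scale (fps_nth r n) 1) * Abs_fps (\<lambda>n. scale (fps_nth s n) 1)"
    by (rule fps_ext) (simp add: fps_mult_nth scale_sum_left scale_mult_left[symmetric])
  have e_one: "Abs_fps (\<lambda>n. scale (fps_nth 1 n) 1) = 1"
    by (rule fps_ext) simp
  show "fps_scale scale r (f + g) = fps_scale scale r f + fps_scale scale r g"
    by (simp add: fps_scale_eq_mult distrib_left)
  have "Abs_fps (\<lambda>n. scale (fps_nth (r + s) n) 1) =
      Abs_fps (\<lambda>n. scale (fps_nth r n) 1) + Abs_fps (\<lambda>n. scale (fps_nth s n) 1)"
    by (rule fps_ext) (simp add: scale_left_distrib)
  then show "fps_scale scale (r + s) f = fps_scale scale r f + fps_scale scale s f"
    by (simp add: fps_scale_eq_mult distrib_right)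
  show "fps_scale scale r (fps_scale scale s f) = fps_scale scale (r * s) f"
    by (simp add: fps_scale_eq_mult e_mult mult.assoc)
  show "fps_scale scale 1 f = f"
    unfolding fps_scale_eq_mult e_one by simp
qed

text \<open>Scalars are restricted to constant series because \<open>assoc_algebra\<close> asks for
  a field. This makes U[[t]] an admissible target for the universal property.\<close>

lemma assoc_algebra_fps: "assoc_algebra (\<lambda>c. fps_scale scale (fps_const c))"
proof -
  interpret fps: module "fps_scale scale" by (rule module_fps_scale)
  show ?thesis
    by unfold_locales
       (simp_all add: fps.scale_right_distrib fps.scale_left_distrib fps_scale_mult_left[symmetric]
         fps_scale_mult_right[symmetric] flip: fps_const_add fps_const_mult)
qed

end

section \<open>Deformed product and twisting map on power series\<close>

text \<open>Each additive \<open>\<alpha> i\<close> can be pulled out of the convolution sum that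
  computes a coefficient of \<open>f * g\<close>.\<close>

lemma formal_mult_compose:
  assumes "\<And>i a b. \<alpha> i (a + b) = \<alpha> i a + \<alpha> i b"
  shows "formal_mult (\<lambda>i a b. \<alpha> i (a * b)) f g = formal_map \<alpha> (f * g :: 'u::ring_1 fps)"
proof -
  have zero: "\<alpha> i 0 = 0" for i
    using assms[of i 0 0] by simp
  have "\<alpha> i (sum h S) = (\<Sum>s\<in>S. \<alpha> i (h s))" for i h and S :: "nat set"
    by (induction S rule: infinite_finite_induct) (simp_all add: zero assms)
  then show ?thesis
    by (intro fps_ext)
       (simp add: formal_mult_def formal_map_def fps_mult_nth atMost_atLeast0)
qed

text \<open>Here \<open>A\<close> sends a series with coefficients f_j to the sum of F(f_j) t^j.
  Since t is central and \<open>F\<close> is multiplicative, \<open>A\<close> is multiplicative; the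
  proof matches coefficients.\<close>

lemma formal_map_mult:
  fixes F :: "'u::ring_1 \<Rightarrow> 'u fps"
  assumes add: "\<And>a b. F (a + b) = F a + F b" and mult: "\<And>a b. F (a * b) = F a * F b"
  defines "A \<equiv> formal_map (\<lambda>i a. fps_nth (F a) i)"
  shows "A (f * g) = A f * A g"
proof (rule fps_ext)
  fix n
  have zero: "F 0 = 0"
    using add[of 0 0] by simp
  have sum: "F (sum h S) = (\<Sum>s\<in>S. F (h s))" for h and S :: "nat set"
    by (induction S rule: infinite_finite_induct) (simp_all add: zero add)
  let ?t = "\<lambda>p j q k. fps_nth (F (fps_nth f j)) p * fps_nth (F (fps_nth g k)) q"
  have "fps_nth (A (f * g)) n = (\<Sum>i\<le>n. \<Sum>j\<le>n - i. \<Sum>p\<le>i. ?t p j (i - p) (n - i - j))"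
    by (simp add: A_def formal_map_def fps_mult_nth sum mult fps_sum_nth atMost_atLeast0)
  also have "\<dots> = (\<Sum>(i, j, p)\<in>(SIGMA i:{..n}. {..n - i} \<times> {..i}). ?t p j (i - p) (n - i - j))"
    by (simp add: sum.Sigma sum.cartesian_product)
  \<comment> \<open>Originally \<open>i\<close> is the total degree produced by \<open>F\<close>,
    with \<open>p\<close> of it coming from the factor of \<open>f\<close>. The new index s = j + p
    is the whole degree contributed by \<open>f\<close>, and q = i - p is the degree that
    \<open>F\<close> produces on the factor of \<open>g\<close>.\<close>
  also have "\<dots> = (\<Sum>(s, p, q)\<in>(SIGMA s:{..n}. {..s} \<times> {..n - s}). ?t p (s - p) q (n - s - q))"
    by (rule sum.reindex_bij_witness[where i = "\<lambda>(s, p, q). (p + q, s - p, p)"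
          and j = "\<lambda>(i, j, p). (j + p, p, i - p)"]) (auto simp: add.commute)
  also have "\<dots> = (\<Sum>s\<le>n. \<Sum>p\<le>s. \<Sum>q\<le>n - s. ?t p (s - p) q (n - s - q))"
    by (simp add: sum.Sigma sum.cartesian_product)
  also have "\<dots> = fps_nth (A f * A g) n"
    by (simp add: A_def formal_map_def fps_mult_nth sum_product atMost_atLeast0)
  finally show "fps_nth (A (f * g)) n = fps_nth (A f * A g) n" .
qed


text \<open>Pascal's rule, over a ring that may be noncommutative, as U(L) is.\<close>

lemma fps_one_plus_X_power_nth: "fps_nth ((1 + fps_X) ^ i :: 'a::ring_1 fps) n = of_nat (i choose n)"
proof (induction i arbitrary: n)
  case 0
  show ?case by (cases n) simp_all
next
  case (Suc i)
  then show ?case by (cases n) (simp_all add: distrib_right add.commute)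
qed

section \<open>The two-dimensional non-abelian Lie algebra\<close>

text \<open>All relators lie in the kernel of \<phi>, so each family yields one of the identities in
  U(L).\<close>

lemma uea_inclusion:
  assumes uea: "universal_enveloping_algebra scaleL bracket scaleU \<iota>"
  shows uea_inclusion_linear: "module_hom scaleL scaleU \<iota>"
    and uea_inclusion_bracket: "\<iota> a * \<iota> b - \<iota> b * \<iota> a = \<iota> (bracket a b)"
proof -
  interpret L: lie_algebra scaleL bracket
    using uea by (simp add: universal_enveloping_algebra_def)
  interpret U: assoc_algebra scaleU
    using uea by (simp add: universal_enveloping_algebra_def)
  obtain \<phi> where \<phi>: "algebra_hom free_scale scaleU \<phi>" "\<And>a. \<phi> (free_gen a) = \<iota> a"
    and ker: "{p. \<phi> p = 0} = two_sided_ideal (uea_relators scaleL bracket)"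
    using uea unfolding universal_enveloping_algebra_def by blast
  interpret \<phi>: module_hom free_scale scaleU \<phi>
    using \<phi>(1) by (simp add: algebra_hom_def)
  have \<phi>_mult: "\<phi> (p * q) = \<phi> p * \<phi> q" for p q
    using \<phi>(1) by (auto simp: algebra_hom_def)
  have rel: "\<phi> p = 0" if "p \<in> uea_relators scaleL bracket" for p
    using ker that by (blast intro: two_sided_ideal.generator)
  show "module_hom scaleL scaleU \<iota>"
  proof unfold_locales
    show "\<iota> (a + b) = \<iota> a + \<iota> b" for a b
    proof -
      have "\<phi> (free_gen (a + b) - (free_gen a + free_gen b)) = 0"
        by (rule rel) (unfold uea_relators_def, blast)
      then show ?thesis
        by (simp add: \<phi>.diff \<phi>.add \<phi>(2))
    qed
    show "\<iota> (scaleL c a) = scaleU c (\<iota> a)" for c a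
    proof -
      have "\<phi> (free_gen (scaleL c a) - free_scale c (free_gen a)) = 0"
        by (rule rel) (unfold uea_relators_def, blast)
      then show ?thesis
        by (simp add: \<phi>.diff \<phi>.scale \<phi>(2))
    qed
  qed
  show "\<iota> a * \<iota> b - \<iota> b * \<iota> a = \<iota> (bracket a b)"
  proof -
    have "\<phi> (free_gen a * free_gen b - free_gen b * free_gen a - free_gen (bracket a b)) = 0"
      by (rule rel) (unfold uea_relators_def, blast)
    then show ?thesis
      by (simp add: \<phi>.diff \<phi>_mult \<phi>(2))
  qed
qed

locale nonabelian_uea =
  fixes scaleL :: "'k::field \<Rightarrow> 'l::ab_group_add \<Rightarrow> 'l"
    and bracket :: "'l \<Rightarrow> 'l \<Rightarrow> 'l"
    and x y :: 'l
    and scaleU :: "'k \<Rightarrow> 'u::ring_1 \<Rightarrow> 'u"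
    and \<iota> :: "'l \<Rightarrow> 'u"
  assumes basis: "x \<noteq> y" "\<not> module.dependent scaleL {x, y}" "module.span scaleL {x, y} = UNIV"
    and bracket_xy: "bracket x y = y"
    and uea: "universal_enveloping_algebra scaleL bracket scaleU \<iota>"
begin

sublocale L: lie_algebra scaleL bracket
  using uea by (simp add: universal_enveloping_algebra_def)

sublocale U: assoc_algebra scaleU
  using uea by (simp add: universal_enveloping_algebra_def)

sublocale \<iota>: module_hom scaleL scaleU \<iota>
  using uea by (rule uea_inclusion_linear)

abbreviation X :: 'u where "X \<equiv> \<iota> x"
abbreviation Y :: 'u where "Y \<equiv> \<iota> y"

section \<open>Normal ordering and spanning by monomials\<close>

lemma XY_commute: "X * Y = Y * X + Y"
  using uea_inclusion_bracket[OF uea, of x y] by (simp add: bracket_xy algebra_simps)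

lemma scale_of_nat: "scaleU (of_nat n) u = of_nat n * u"
  by (induction n) (simp_all add: U.scale_left_distrib distrib_right)

text \<open>Moving \<open>X\<close> to the right past powers of \<open>Y\<close> leaves only
  monomials with \<open>Y\<close> before \<open>X\<close>; this drives the spanning argument
  below.\<close>

lemma X_mult_Y_power: "X * Y ^ i = Y ^ i * X + of_nat i * Y ^ i"
proof (induction i)
  case (Suc i)
  have "X * Y ^ Suc i = (Y ^ i * X + of_nat i * Y ^ i) * Y"
    by (simp only: power_Suc2 mult.assoc[symmetric] Suc)
  also have "\<dots> = Y ^ Suc i * X + of_nat (Suc i) * Y ^ Suc i"
    by (simp add: distrib_left distrib_right mult.assoc XY_commute power_Suc2 del: power_Suc)
  finally show ?case .
qed simp

lemma basis_induct [case_names zero add scale x y]: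
  assumes "P 0" and "\<And>a b. P a \<Longrightarrow> P b \<Longrightarrow> P (a + b)"
    and "\<And>c a. P a \<Longrightarrow> P (scaleL c a)" and "P x" and "P y"
  shows "P a"
proof -
  have "a \<in> L.span {x, y}"
    using basis(3) by simp
  then show ?thesis
    by (induction rule: L.span_induct_alt) (auto intro: assms)
qed

text \<open>The spanning half of the Poincare-Birkhoff-Witt theorem as an induction rule. The span
  \<open>S\<close> of the ordered monomials is stable under left multiplication by \<open>X\<close>
  and \<open>Y\<close>, hence by all of U(L), and it contains 1.\<close>

lemma monomial_induct [case_names add scale monomial]:
  assumes add: "\<And>u v. P u \<Longrightarrow> P v \<Longrightarrow> P (u + v)"
    and scale: "\<And>c u. P u \<Longrightarrow> P (scaleU c u)"
    and monomial: "\<And>i j. P (Y ^ i * X ^ j)"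
  shows "P u"
proof -
  have zero: "P 0"
    using scale[of _ 0, OF monomial] by simp
  define S where "S = U.span (range (\<lambda>(i, j). Y ^ i * X ^ j))"
  have base: "Y ^ i * X ^ j \<in> S" for i j
    unfolding S_def by (rule U.span_base) auto
  have left_mult: "u * s \<in> S"
    if "\<And>i j. u * (Y ^ i * X ^ j) \<in> S" and "s \<in> S" for u s
    using that(2) unfolding S_def
  proof (induction rule: U.span_induct_alt)
    case base
    show ?case by (simp add: U.span_zero)
  next
    case (step c v w)
    then show ?case
      using that(1) unfolding S_def
      by (auto simp: distrib_left U.scale_mult_right[symmetric] intro!: U.span_add U.span_scale)
  qed
  have X: "X * (Y ^ i * X ^ j) \<in> S" for i j
  proof -
    have "X * (Y ^ i * X ^ j) = (X * Y ^ i) * X ^ j"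
      by (simp only: mult.assoc)
    also have "\<dots> = Y ^ i * X ^ Suc j + scaleU (of_nat i) (Y ^ i * X ^ j)"
      by (simp only: X_mult_Y_power distrib_right scale_of_nat mult.assoc power_Suc)
    finally show ?thesis
      using base[of i "Suc j"] base[of i j] unfolding S_def by (metis U.span_add U.span_scale)
  qed
  have Y: "Y * (Y ^ i * X ^ j) \<in> S" for i j
    using base[of "Suc i" j] by (simp add: mult.assoc)
  have gen: "\<iota> a * s \<in> S" if "s \<in> S" for a s
    using that
  proof (induction a rule: basis_induct)
    case zero
    then show ?case by (simp add: S_def U.span_zero)
  next
    case (add a b)
    then show ?case
      unfolding S_def by (simp add: \<iota>.add distrib_right U.span_add)
  next
    case (scale c a)
    then show ?case
      unfolding S_def by (simp add: \<iota>.scale U.scale_mult_left[symmetric] U.span_scale)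
  qed (auto intro: left_mult X Y)
  have "\<forall>s\<in>S. u * s \<in> S"
    using uea
  proof (induction u rule: uea_induct)
    case (add u v)
    then show ?case by (simp add: distrib_right S_def U.span_add)
  next
    case (scale c u)
    then show ?case by (simp add: U.scale_mult_left[symmetric] S_def U.span_scale)
  qed (auto simp: gen mult.assoc)
  \<comment> \<open>\<open>base[of 0 0]\<close> puts the unit into \<open>S\<close>, and u = u *
    1.\<close>
  then have "u \<in> S"
    using base[of 0 0] by fastforce
  then show ?thesis
    unfolding S_def
    by (induction rule: U.span_induct_alt) (auto intro: zero add scale monomial)
qed

section \<open>Homomorphisms determined by the images of x and y\<close>

text \<open>Bilinearity and alternation reduce compatibility with the bracket to the basis, where
  the only substantial condition is the relation between \<xi> and \<eta>.\<close>

lemma lift_hom: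
  fixes \<xi> \<eta> :: "'b::ring_1"
  assumes B: "assoc_algebra scaleB" and rel: "\<xi> * \<eta> - \<eta> * \<xi> = \<eta>"
  obtains F where "algebra_hom scaleU scaleB F" and "F X = \<xi>" and "F Y = \<eta>"
proof -
  interpret B: assoc_algebra scaleB by (rule B)
  interpret LB: vector_space_pair scaleL scaleB ..
  obtain g where g: "Vector_Spaces.linear scaleL scaleB g"
    and g_xy: "\<forall>z\<in>{x, y}. g z = (if z = x then \<xi> else \<eta>)"
    using LB.linear_independent_extend[OF basis(2), of "\<lambda>z. if z = x then \<xi> else \<eta>"] by blast
  interpret g: Vector_Spaces.linear scaleL scaleB g by (rule g)
  have bilin: "module_hom scaleL scaleL (bracket a)" "module_hom scaleL scaleL (\<lambda>a. bracket a b)"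
    for a b
    using L.bilinear by (auto simp: bilinear_op_def)
  have br_simps: "bracket (a + b) c = bracket a c + bracket b c"
      "bracket c (a + b) = bracket c a + bracket c b"
      "bracket (scaleL r a) c = scaleL r (bracket a c)"
      "bracket c (scaleL r a) = scaleL r (bracket c a)"
      "bracket 0 c = 0" "bracket c 0 = 0" for a b c r
    by (rule module_hom.add[OF bilin(2)] module_hom.add[OF bilin(1)] module_hom.scale[OF bilin(2)]
        module_hom.scale[OF bilin(1)] module_hom.zero[OF bilin(2)] module_hom.zero[OF bilin(1)])+
  \<comment> \<open>Antisymmetry, from expanding \<open>bracket (x + y) (x + y) = 0\<close>.\<close>
  have "bracket x y + bracket y x = 0"
    using L.alternating[of "x + y"] unfolding br_simps
    by (simp add: L.alternating add.commute)
  then have bracket_yx: "bracket y x = - y"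
    by (simp add: bracket_xy eq_neg_iff_add_eq_0 add.commute)
  have g_xy': "g x = \<xi>" "g y = \<eta>"
    using basis(1) g_xy by auto
  have rel': "\<eta> * \<xi> - \<xi> * \<eta> = - \<eta>"
    using rel by (metis minus_diff_eq)
  have diff_add: "(u + v) * w - w * (u + v) = (u * w - w * u) + (v * w - w * v)"
    and diff_add': "w * (u + v) - (u + v) * w = (w * u - u * w) + (w * v - v * w)" for u v w :: 'b
    by (simp_all add: distrib_left distrib_right)
  have diff_scale: "scaleB c u * v - v * scaleB c u = scaleB c (u * v - v * u)"
    and diff_scale': "v * scaleB c u - scaleB c u * v = scaleB c (v * u - u * v)" for c u v
    by (simp_all only: B.scale_mult_left[symmetric] B.scale_mult_right[symmetric]
        B.scale_right_diff_distrib)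
  \<comment> \<open>The identity is linear in each argument: first \<open>x\<close> and then
    \<open>y\<close> is fixed on the left while \<open>b\<close> varies, and finally the left
    argument varies.\<close>
  have "g x * g b - g b * g x = g (bracket x b)" for b
    by (induction b rule: basis_induct)
       (simp_all only: br_simps g.zero g.add g.scale diff_add' diff_scale' L.alternating
         g_xy' bracket_xy rel mult_zero_left mult_zero_right diff_self)
  moreover have "g y * g b - g b * g y = g (bracket y b)" for b
    by (induction b rule: basis_induct)
       (simp_all only: br_simps g.zero g.add g.scale g.neg diff_add' diff_scale' L.alternating
         g_xy' bracket_yx rel' mult_zero_left mult_zero_right diff_self)
  ultimately have comm: "g a * g b - g b * g a = g (bracket a b)" for a b
    by (induction a rule: basis_induct)
       (simp_all only: br_simps g.zero g.add g.scale diff_add diff_scale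
         mult_zero_left mult_zero_right diff_self)
  obtain F where F: "algebra_hom scaleU scaleB F" and F_\<iota>: "\<And>a. F (\<iota> a) = g a"
    using uea_universal_property[OF uea B g.module_hom_axioms comm] by blast
  show ?thesis
    by (rule that[of F]) (simp_all add: F F_\<iota> g_xy')
qed

lemma deformation_hom:
  obtains F where "algebra_hom scaleU (\<lambda>c. fps_scale scaleU (fps_const c)) F"
    and "\<And>i j n. fps_nth (F (Y ^ i * X ^ j)) n = scaleU (of_nat (i choose n)) (Y ^ i * X ^ j)"
proof -
  define T where "T = (1 + fps_X :: 'u fps)"
  have T_commute: "T * f = f * T" for f
    by (simp add: T_def distrib_left distrib_right fps_mult_fps_X_commute)
  \<comment> \<open>The series T = 1 + t is central, so it can be collected on the right of each
    product; the relation for the deformed \<open>Y\<close> is then \<open>T\<close> times the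
    relation in U(L).\<close>
  have "fps_const Y * T * fps_const X = fps_const (Y * X) * T"
    by (metis T_commute mult.assoc fps_const_mult)
  moreover have "fps_const X * (fps_const Y * T) = fps_const (X * Y) * T"
    by (metis mult.assoc fps_const_mult)
  ultimately have "fps_const X * (fps_const Y * T) - fps_const Y * T * fps_const X = fps_const Y * T"
    by (simp add: XY_commute distrib_right del: fps_const_add flip: fps_const_add)
  then obtain F where F: "algebra_hom scaleU (\<lambda>c. fps_scale scaleU (fps_const c)) F"
    and FX: "F X = fps_const X" and FY: "F Y = fps_const Y * T"
    using lift_hom[OF U.assoc_algebra_fps] by blast
  have F_mult: "F (u * v) = F u * F v" and F_one: "F 1 = 1" for u v
    using F by (auto simp: algebra_hom_def)
  have F_power: "F (u ^ n) = F u ^ n" for u n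
    by (induction n) (simp_all add: F_mult F_one)
  have power: "(fps_const Y * T) ^ i = fps_const (Y ^ i) * T ^ i" for i
  proof (induction i)
    case (Suc i)
    have "(fps_const Y * T) ^ Suc i = fps_const Y * (T * fps_const (Y ^ i)) * T ^ i"
      by (simp only: power_Suc Suc mult.assoc)
    also have "T * fps_const (Y ^ i) = fps_const (Y ^ i) * T"
      by (rule T_commute)
    also have "fps_const Y * (fps_const (Y ^ i) * T) * T ^ i = fps_const (Y ^ Suc i) * T ^ Suc i"
      by (simp only: power_Suc mult.assoc fps_const_mult[symmetric])
    finally show ?case .
  qed simp
  have "F (Y ^ i * X ^ j) = fps_const (Y ^ i * X ^ j) * T ^ i" for i j
  proof -
    have "F (Y ^ i * X ^ j) = fps_const (Y ^ i) * (T ^ i * fps_const (X ^ j))"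
      by (simp only: F_mult F_power FX FY power mult.assoc fps_const_power)
    also have "T ^ i * fps_const (X ^ j) = fps_const (X ^ j) * T ^ i"
      by (rule power_commuting_commutes) (rule T_commute)
    finally show ?thesis
      by (simp only: mult.assoc fps_const_mult[symmetric])
  qed
  then have "fps_nth (F (Y ^ i * X ^ j)) n = scaleU (of_nat (i choose n)) (Y ^ i * X ^ j)" for i j n
    by (simp only: fps_mult_left_const_nth T_def fps_one_plus_X_power_nth scale_of_nat
        mult_of_nat_commute)
  with F show ?thesis by (rule that)
qed

section \<open>Assembling the deformation and comparing it with the family\<close>

theorem twisted_family_is_formal_deformation:
  "family_is_formal_deformation scaleU (*) id 1 (uk_mult scaleU X Y) (uk_twist scaleU X Y)"
proof -
  obtain F where F: "algebra_hom scaleU (\<lambda>c. fps_scale scaleU (fps_const c)) F"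
    and F_monomial:
      "\<And>i j n. fps_nth (F (Y ^ i * X ^ j)) n = scaleU (of_nat (i choose n)) (Y ^ i * X ^ j)"
    using deformation_hom by blast
  interpret F: module_hom scaleU "\<lambda>c. fps_scale scaleU (fps_const c)" F
    using F by (simp add: algebra_hom_def)
  have F_mult: "F (u * v) = F u * F v" and F_one: "F 1 = 1" for u v
    using F by (auto simp: algebra_hom_def)
  define \<alpha> where "\<alpha> n u = fps_nth (F u) n" for n u
  define m where "m n a b = \<alpha> n (a * b)" for n a b
  have \<alpha>_add: "\<alpha> n (a + b) = \<alpha> n a + \<alpha> n b" for n a b
    by (simp add: \<alpha>_def F.add)
  have \<alpha>_scale: "\<alpha> n (scaleU c a) = scaleU c (\<alpha> n a)" for n c a
    by (simp add: \<alpha>_def F.scale U.fps_scale_const)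
  have \<alpha>_hom: "module_hom scaleU scaleU (\<alpha> n)" for n
    by unfold_locales (simp_all add: \<alpha>_add \<alpha>_scale)
  have \<alpha>_monomial: "\<alpha> n (Y ^ i * X ^ j) = scaleU (of_nat (i choose n)) (Y ^ i * X ^ j)" for n i j
    by (simp add: \<alpha>_def F_monomial)

  \<comment> \<open>The binomial coefficient vanishes for n > i, so on a monomial the expansion is a
    polynomial in t of degree at most i.\<close>
  have \<alpha>_support: "{n. \<alpha> n (Y ^ i * X ^ j) \<noteq> 0} \<subseteq> {..i}" for i j
  proof
    fix n
    assume "n \<in> {n. \<alpha> n (Y ^ i * X ^ j) \<noteq> 0}"
    then have "i choose n \<noteq> 0"
      by (intro notI) (simp add: \<alpha>_monomial)
    then show "n \<in> {..i}"
      by (simp add: binomial_eq_0_iff)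
  qed
  have \<alpha>_0: "\<alpha> 0 u = u" for u
    by (induction u rule: monomial_induct) (simp_all add: \<alpha>_add \<alpha>_scale \<alpha>_monomial)
  have \<alpha>_finite: "finite {n. \<alpha> n u \<noteq> 0}" for u
  proof (induction u rule: monomial_induct)
    case (add u v)
    show ?case
      by (rule finite_subset[OF _ finite_UnI[OF add]]) (auto simp: \<alpha>_add)
  next
    case (scale c u)
    show ?case
      by (rule finite_subset[OF _ scale]) (auto simp: \<alpha>_scale)
  next
    case (monomial i j)
    show ?case
      by (rule finite_subset[OF \<alpha>_support]) simp
  qed

  have bilinear: "bilinear_op scaleU (m n)" for n
    unfolding bilinear_op_def
    by (intro conjI allI; unfold_locales)
       (simp_all add: m_def \<alpha>_add \<alpha>_scale distrib_left distrib_right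
         flip: U.scale_mult_left U.scale_mult_right)
  have m_0: "m 0 = (*)"
    by (intro ext) (simp add: m_def \<alpha>_0)
  have alg: "hom_associative_algebra scaleU (*) id"
    using bilinear[of 0] unfolding m_0
    by unfold_locales (simp_all add: mult.assoc)

  define A where "A = formal_map \<alpha>"
  have A_mult: "A (f * g) = A f * A g" for f g
    unfolding A_def \<alpha>_def by (rule formal_map_mult) (simp_all add: F.add F_mult)
  have m_A: "formal_mult m f g = A (f * g)" for f g
    unfolding A_def m_def by (rule formal_mult_compose) (rule \<alpha>_add)
  have \<alpha>_one: "\<alpha> n 1 = (if n = 0 then 1 else 0)" for n
    by (simp add: \<alpha>_def F_one)
  have A_add: "A (f + g) = A f + A g" for f g
    by (rule fps_ext) (simp add: A_def formal_map_def \<alpha>_add sum.distrib)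
  \<comment> \<open>Since F 1 = 1, \<open>A\<close> fixes the image of every scalar series; with
    multiplicativity this gives K[[t]]-linearity.\<close>
  have A_coeff: "A (Abs_fps (\<lambda>n. scaleU (fps_nth r n) 1)) = Abs_fps (\<lambda>n. scaleU (fps_nth r n) 1)"
    for r
    by (rule fps_ext)
       (simp add: A_def formal_map_def \<alpha>_scale \<alpha>_one if_distrib[of "scaleU _"] cong: if_cong)
  have A_scale: "A (fps_scale scaleU r f) = fps_scale scaleU r (A f)" for r f
    by (simp add: U.fps_scale_eq_mult A_mult A_coeff)
  interpret fps: module "fps_scale scaleU" by (rule U.module_fps_scale)
  \<comment> \<open>Both sides of hom-associativity are equal to A(A(a b c)), by multiplicativity of
    \<open>A\<close> and associativity.\<close>
  have "hom_associative_algebra (fps_scale scaleU) (formal_mult m) A"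
  proof unfold_locales
    show "bilinear_op (fps_scale scaleU) (formal_mult m)"
      unfolding bilinear_op_def
      by (intro conjI allI; unfold_locales)
         (simp_all add: m_A A_add A_scale distrib_left distrib_right
           flip: U.fps_scale_mult_left U.fps_scale_mult_right)
  qed (simp_all add: A_add A_scale m_A A_mult mult.assoc)
  with alg bilinear \<alpha>_hom have deformation:
      "formal_hom_assoc_deformation scaleU (*) id m \<alpha>"
    by (auto simp: formal_hom_assoc_deformation_def m_0 \<alpha>_0 A_def)

  have twist: "uk_twist scaleU X Y k u = (\<Sum>n | \<alpha> n u \<noteq> 0. scaleU ((k - 1) ^ n) (\<alpha> n u))" for k u
  proof -
    \<comment> \<open>The evaluation at t = k - 1 of the series F(u), which has finitely many
      nonzero coefficients.\<close>
    define f where "f u = (\<Sum>n | \<alpha> n u \<noteq> 0. scaleU ((k - 1) ^ n) (\<alpha> n u))" for u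
    \<comment> \<open>The index set in \<open>f\<close> depends on the argument; a common finite
      superset allows comparison of different arguments.\<close>
    have f_eq: "f u = (\<Sum>n\<in>S. scaleU ((k - 1) ^ n) (\<alpha> n u))"
      if "finite S" "{n. \<alpha> n u \<noteq> 0} \<subseteq> S" for S u
      unfolding f_def using that by (intro sum.mono_neutral_left) auto
    have hom: "module_hom scaleU scaleU f"
    proof unfold_locales
      fix a b c
      let ?S = "{n. \<alpha> n a \<noteq> 0} \<union> {n. \<alpha> n b \<noteq> 0}"
      have "finite ?S" "{n. \<alpha> n (a + b) \<noteq> 0} \<subseteq> ?S"
        by (auto simp: \<alpha>_finite \<alpha>_add)
      then show "f (a + b) = f a + f b"
        by (simp add: f_eq[of ?S] \<alpha>_add U.scale_right_distrib sum.distrib)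
      have "{n. \<alpha> n (scaleU c a) \<noteq> 0} \<subseteq> {n. \<alpha> n a \<noteq> 0}"
        by (auto simp: \<alpha>_scale)
      then show "f (scaleU c a) = scaleU c (f a)"
        by (simp add: f_eq[of "{n. \<alpha> n a \<noteq> 0}"] \<alpha>_finite \<alpha>_scale U.scale_sum_right mult.commute)
    qed
    have monomial: "f (Y ^ i * X ^ j) = scaleU (k ^ i) (Y ^ i * X ^ j)" for i j
    proof -
      have "f (Y ^ i * X ^ j) =
          scaleU (\<Sum>n\<le>i. of_nat (i choose n) * (k - 1) ^ n) (Y ^ i * X ^ j)"
        by (simp add: f_eq[OF _ \<alpha>_support] \<alpha>_monomial U.scale_sum_left mult.commute)
      \<comment> \<open>The binomial theorem for k = (k - 1) + 1.\<close>
      also have "(\<Sum>n\<le>i. of_nat (i choose n) * (k - 1) ^ n) = k ^ i"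
        using binomial_ring[of "k - 1" 1 i] by simp
      finally show ?thesis .
    qed
    \<comment> \<open>For the definite description, \<open>f\<close> supplies existence, and
      uniqueness holds because linear maps agreeing on the spanning monomials coincide.\<close>
    have "uk_twist scaleU X Y k = f"
      unfolding uk_twist_def
    proof (rule the_equality)
      fix h
      assume h: "module_hom scaleU scaleU h \<and>
        (\<forall>i j. h (Y ^ i * X ^ j) = scaleU (k ^ i) (Y ^ i * X ^ j))"
      interpret f: module_hom scaleU scaleU f by (rule hom)
      interpret h: module_hom scaleU scaleU h using h by blast
      have "h u = f u" for u
        by (induction u rule: monomial_induct)
           (simp_all add: f.add h.add f.scale h.scale h monomial)
      then show "h = f" by (rule ext)
    qed (use hom monomial in simp)
    then show ?thesis
      by (simp add: f_def)
  qed
  show ?thesis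
    unfolding family_is_formal_deformation_def
    using deformation \<alpha>_finite
    by (intro exI[of _ m] exI[of _ \<alpha>]) (simp add: twist uk_mult_def m_def)
qed

end

theorem proposition5:
  fixes scaleL :: "'k::field_char_0 \<Rightarrow> 'l::ab_group_add \<Rightarrow> 'l"
    and bracket :: "'l \<Rightarrow> 'l \<Rightarrow> 'l"
    and x y :: 'l
    and scaleU :: "'k \<Rightarrow> 'u::ring_1 \<Rightarrow> 'u"
    and \<iota> :: "'l \<Rightarrow> 'u"
  assumes lie: "lie_algebra scaleL bracket"
    and basis: "x \<noteq> y" "\<not> module.dependent scaleL {x, y}" "module.span scaleL {x, y} = UNIV"
    and bracket_xy: "bracket x y = y"
    and uea: "universal_enveloping_algebra scaleL bracket scaleU \<iota>"
  shows "family_is_formal_deformation scaleU (*) id 1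
           (uk_mult scaleU (\<iota> x) (\<iota> y)) (uk_twist scaleU (\<iota> x) (\<iota> y))"
proof -
  interpret nonabelian_uea scaleL bracket x y scaleU \<iota>
    by unfold_locales (fact basis bracket_xy uea)+
  show ?thesis by (rule twisted_family_is_formal_deformation)
qed

end
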